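(* Let $p>2$ and let $n$ be the dimension. There is a constant $C=C(n,p)$ such that the following holds. Let $\Omega\subset\mathbb{R}^n$ be a bounded domain, let $\varepsilon>0$, and let $u_\varepsilon$ be a positive $p$-harmonious function in $\Omega$ (with step size $\varepsilon$). Then $$\operatorname{osc}(u_\varepsilon,B_\rho)\le C\,\frac{\rho}{r}\,\operatorname{osc}(u_\varepsilon,B_r)$$ whenever $\varepsilon\le\rho\le r$ and $B_\rho,B_r,B_{2r}$ are concentric open balls of radii $\rho,r,2r$ with $B_{2r}\subset\Omega$.
   Context: $\operatorname{osc}(u,B)=\sup_B u-\inf_B u$. $B_\rho(x)$ denotes the open ball of radius $\rho$ centered at $x$ in $\mathbb{R}^n$. Fix $p>2$ and set $\alpha=\frac{p-2}{n+p}$, $\beta=\frac{n+2}{n+p}$, so $\alpha+\beta=1$. For a bounded domain $\Omega\subset\mathbb{R}^n$ and $\varepsilon>0$ let $\Gamma_\varepsilon=\{x\in\mathbb{R}^n\setminus\Omega:\operatorname{dist}(x,\partial\Omega)\le\varepsilon\}$ and $\Omega_\varepsilon=\Omega\cup\Gamma_\varepsilon$. A $p$-harmonious function in $\Omega$ (with step size $\varepsilon$) is a bounded Borel measurable function $u_\varepsilon:\Omega_\varepsilon\to\mathbb{R}$ satisfying the dynamic programming principle $$u_\varepsilon(x)=\frac{\alpha}{2}\Big\{\inf_{B_\varepsilon(x)}u_\varepsilon+\sup_{B_\varepsilon(x)}u_\varepsilon\Big\}+\frac{\beta}{|B_\varepsilon(x)|}\int_{B_\varepsilon(x)}u_\varepsilon\,dy\qquad\text{for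 all }x\in\Omega.$$ (Equivalently, it is the value of the tug-of-war with noise game with payoff $F=u_\varepsilon|_{\Gamma_\varepsilon}$.) It is called positive if $u_\varepsilon>0$. *)

theory Defs
  imports "HOL-Analysis.Analysis"
begin

definition osc :: "('a \<Rightarrow> real) \<Rightarrow> 'a set \<Rightarrow> real" where
  "osc u B = (SUP x\<in>B. u x) - (INF x\<in>B. u x)"

definition bounded_domain :: "(real ^ 'n) set \<Rightarrow> bool" where
  "bounded_domain \<Omega> \<longleftrightarrow> \<Omega> \<noteq> {} \<and> open \<Omega> \<and> connected \<Omega> \<and> bounded \<Omega>"

definition boundary_strip :: "real \<Rightarrow> (real ^ 'n) set \<Rightarrow> (real ^ 'n) set" where
  "boundary_strip \<epsilon> \<Omega> = {x. x \<notin> \<Omega> \<and> infdist x (frontier \<Omega>) \<le> \<epsilon>}"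

definition extended_domain :: "real \<Rightarrow> (real ^ 'n) set \<Rightarrow> (real ^ 'n) set" where
  "extended_domain \<epsilon> \<Omega> = \<Omega> \<union> boundary_strip \<epsilon> \<Omega>"

definition tug_weight :: "'n::finite itself \<Rightarrow> real \<Rightarrow> real" where
  "tug_weight _ p = (p - 2) / (real CARD('n) + p)"

definition noise_weight :: "'n::finite itself \<Rightarrow> real \<Rightarrow> real" where
  "noise_weight _ p = (real CARD('n) + 2) / (real CARD('n) + p)"

(* A function on the extended domain is represented by a total function. Its values elsewhere
   are irrelevant: for x in \<Omega>, the ball of radius \<epsilon> around x lies in the extended domain. *)
definition p_harmonious :: "real \<Rightarrow> real \<Rightarrow> (real ^ 'n::finite) set \<Rightarrow> (real ^ 'n \<Rightarrow> real) \<Rightarrow> bool" where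
  "p_harmonious p \<epsilon> \<Omega> u \<longleftrightarrow>
     bounded (u ` extended_domain \<epsilon> \<Omega>) \<and>
     u \<in> borel_measurable (restrict_space borel (extended_domain \<epsilon> \<Omega>)) \<and>
     (\<forall>x\<in>\<Omega>. u x =
        tug_weight TYPE('n) p / 2 * ((INF y\<in>ball x \<epsilon>. u y) + (SUP y\<in>ball x \<epsilon>. u y)) +
        noise_weight TYPE('n) p / measure lborel (ball x \<epsilon>) * (LINT y:ball x \<epsilon>|lborel. u y))"

end

theory Submission
  imports Defs
begin

text \<open>The proof is an analytic form of the cancellation strategy for tug-of-war with noise. Let
  \<open>O\<^sub>k(x)\<close> be the oscillation of \<open>u\<close> over the ball of radius \<open>k\<epsilon>\<close> around \<open>x\<close>, and \<open>O\<^sub>0 = 0\<close>. Take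
  two points of that ball and subtract their dynamic programming equations. The larger supremum
  and the smaller infimum are taken over points at most one step further away from \<open>x\<close>, so their
  difference is at most \<open>O\<^sub>k\<^sub>+\<^sub>1(x)\<close>. For the other two terms each token may instead cancel one
  step and return to the ball of radius \<open>(k - 1)\<epsilon>\<close>, which gives \<open>O\<^sub>k\<^sub>-\<^sub>1(x)\<close>. Using the same
  noise vector \<open>v\<close> at both points bounds the integrals by the mean of \<open>O\<^sub>k(x + v)\<close>. Hence
  \<open>O\<^sub>k(x) \<le> \<alpha>/2 (O\<^sub>k\<^sub>+\<^sub>1(x) + O\<^sub>k\<^sub>-\<^sub>1(x)) + \<beta> mean O\<^sub>k(x + v)\<close>: in the variables \<open>(x, k\<epsilon>)\<close>, the
  oscillation is a discrete subsolution of a uniformly elliptic equation on a half space and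
  vanishes on its boundary \<open>k = 0\<close>.\<close>

text \<open>Such a function grows at most linearly away from the boundary. With \<open>\<omega>\<close> the oscillation
  over the ball of radius \<open>r\<close> around \<open>c\<close>, this is seen by comparison with \<open>\<omega>\<close> times the explicit
  strict supersolution \<open>16 |x - c|\<^sup>2/r\<^sup>2 + (d/2 + 4) t/r - d t\<^sup>2/r\<^sup>2\<close>, \<open>t = k\<epsilon>\<close>
  (lemma \<open>below_barrier_0\<close>). Since \<open>\<alpha> > 0\<close>, the concavity in \<open>t\<close> can be chosen large enough to beat
  the convexity in \<open>x\<close>; this is where \<open>p > 2\<close> enters. At \<open>x = c\<close> the barrier is at most
  \<open>(d/2 + 4) k\<epsilon>/r\<close>, and taking for \<open>k\<epsilon>\<close> the first multiple of \<open>\<epsilon>\<close> that is not below \<open>\<rho>\<close> gives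
  the estimate when \<open>\<rho> \<le> r/4\<close>. For larger \<open>\<rho>\<close> it holds because \<open>4\<rho>/r \<ge> 1\<close>.\<close>

section \<open>Averages over balls\<close>

lemma lborel_integral_affine_isometry:
  fixes f :: "'a::euclidean_space \<Rightarrow> real"
  assumes s: "\<bar>s\<bar> = 1" and f: "f \<in> borel_measurable borel"
  shows "(LINT v|lborel. f (t + s *\<^sub>R v)) = (LINT y|lborel. f y)"
proof -
  have "(lborel :: 'a measure) = density (distr lborel borel (\<lambda>v. t + s *\<^sub>R v)) (\<lambda>_. 1)"
    using lborel_affine[of s t] s by fastforce
  then have "(lborel :: 'a measure) = distr lborel borel (\<lambda>v. t + s *\<^sub>R v)"
    by (simp add: density_1)
  then have "(LINT y|lborel. f y) = (LINT y|distr lborel borel (\<lambda>v. t + s *\<^sub>R v). f y)"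
    by simp
  also have "\<dots> = (LINT v|lborel. f (t + s *\<^sub>R v))"
    using f by (intro integral_distr) auto
  finally show ?thesis by simp
qed

lemma lborel_distr_translation: "distr lborel borel (\<lambda>v. y + v) = (lborel :: 'a::euclidean_space measure)"
  using lborel_affine[of 1 y] by (simp add: density_1)

lemma set_integrable_ball_translate:
  fixes f :: "'a::euclidean_space \<Rightarrow> real"
  assumes "set_integrable lborel (ball y \<epsilon>) f"
  shows "set_integrable lborel (ball 0 \<epsilon>) (\<lambda>v. f (y + v))"
proof -
  have "integrable (distr lborel borel (\<lambda>v. y + v)) (\<lambda>z. indicator (ball y \<epsilon>) z *\<^sub>R f z)"
    unfolding lborel_distr_translation using assms by (simp add: set_integrable_def)
  then have "integrable lborel (\<lambda>v. indicator (ball y \<epsilon>) (y + v) *\<^sub>R f (y + v))"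
    using assms by (subst (asm) integrable_distr_eq) (auto simp: set_integrable_def)
  moreover have "indicator (ball y \<epsilon>) (y + v) = (indicator (ball 0 \<epsilon>) v :: real)" for v
    by (simp add: indicator_def dist_norm)
  ultimately show ?thesis by (simp add: set_integrable_def)
qed

lemma set_integral_ball_translate:
  fixes f :: "'a::euclidean_space \<Rightarrow> real"
  assumes "set_integrable lborel (ball y \<epsilon>) f"
  shows "(LINT z:ball y \<epsilon>|lborel. f z) = (LINT v:ball 0 \<epsilon>|lborel. f (y + v))"
proof -
  have "(LINT z:ball y \<epsilon>|lborel. f z) =
      (LINT v|lborel. indicator (ball y \<epsilon>) (y + 1 *\<^sub>R v) *\<^sub>R f (y + 1 *\<^sub>R v))"
    unfolding set_lebesgue_integral_def using assms
    by (intro lborel_integral_affine_isometry[symmetric]) (auto simp: set_integrable_def)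
  moreover have "indicator (ball y \<epsilon>) (y + v) = (indicator (ball 0 \<epsilon>) v :: real)" for v
    by (simp add: indicator_def dist_norm)
  ultimately show ?thesis by (simp add: set_lebesgue_integral_def)
qed

lemma set_integrable_ball_continuous:
  fixes f :: "'a::euclidean_space \<Rightarrow> real"
  assumes "continuous_on UNIV f"
  shows "set_integrable lborel (ball x \<epsilon>) f"
proof -
  have "set_integrable lborel (cball x \<epsilon>) f"
    unfolding set_integrable_def
    by (intro borel_integrable_compact continuous_on_subset[OF assms]) auto
  then show ?thesis
    by (rule set_integrable_subset) auto
qed

text \<open>The cross term of the square is odd, so it disappears when the ball is averaged together with
  its reflection.\<close>

lemma set_integral_norm_square_le:
  fixes w :: "'a::euclidean_space"
  assumes "\<epsilon> > 0"
  shows "(LINT v:ball 0 \<epsilon>|lborel. (norm (w + v))\<^sup>2)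
           \<le> ((norm w)\<^sup>2 + \<epsilon>\<^sup>2) * measure lborel (ball (0::'a) \<epsilon>)"
proof -
  let ?B = "ball (0::'a) \<epsilon>"
  have int: "set_integrable lborel ?B (\<lambda>v. (norm (w + v))\<^sup>2)"
    "set_integrable lborel ?B (\<lambda>v. (norm (w - v))\<^sup>2)"
    by (intro set_integrable_ball_continuous continuous_intros)+
  have "(LINT v|lborel. indicator ?B (0 + (-1) *\<^sub>R v) *\<^sub>R (norm (w + (0 + (-1) *\<^sub>R v)))\<^sup>2)
      = (LINT v|lborel. indicator ?B v *\<^sub>R (norm (w + v))\<^sup>2)"
    using int(1)
    by (intro lborel_integral_affine_isometry) (auto simp: set_integrable_def)
  then have reflect: "(LINT v:?B|lborel. (norm (w - v))\<^sup>2) = (LINT v:?B|lborel. (norm (w + v))\<^sup>2)"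
    by (simp add: set_lebesgue_integral_def indicator_def)
  have "2 * (LINT v:?B|lborel. (norm (w + v))\<^sup>2)
      = (LINT v:?B|lborel. (norm (w + v))\<^sup>2 + (norm (w - v))\<^sup>2)"
    using set_integral_add(2)[OF int] reflect by simp
  also have "\<dots> \<le> (LINT v:?B|lborel. 2 * ((norm w)\<^sup>2 + \<epsilon>\<^sup>2))"
  proof (rule set_integral_mono)
    fix v :: 'a assume "v \<in> ?B"
    then have "(norm v)\<^sup>2 \<le> \<epsilon>\<^sup>2" by (intro power_mono) auto
    moreover have "(norm (w + v))\<^sup>2 + (norm (w - v))\<^sup>2 = 2 * ((norm w)\<^sup>2 + (norm v)\<^sup>2)"
      by (simp add: power2_norm_eq_inner inner_add_left inner_add_right inner_diff_left
          inner_diff_right inner_commute)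
    ultimately show "(norm (w + v))\<^sup>2 + (norm (w - v))\<^sup>2 \<le> 2 * ((norm w)\<^sup>2 + \<epsilon>\<^sup>2)"
      by simp
  qed (intro set_integrable_ball_continuous continuous_intros)+
  also have "\<dots> = 2 * (((norm w)\<^sup>2 + \<epsilon>\<^sup>2) * measure lborel ?B)"
    by (simp add: set_lebesgue_integral_def)
  finally show ?thesis by simp
qed

section \<open>One round of the game, played from two points\<close>

definition tug_noise_average ::
    "real \<Rightarrow> real \<Rightarrow> real \<Rightarrow> ('a::euclidean_space \<Rightarrow> real) \<Rightarrow> 'a \<Rightarrow> real" where
  "tug_noise_average \<alpha> \<beta> \<epsilon> u x =
     \<alpha> / 2 * ((INF y\<in>ball x \<epsilon>. u y) + (SUP y\<in>ball x \<epsilon>. u y)) +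
     \<beta> / measure lborel (ball x \<epsilon>) * (LINT y:ball x \<epsilon>|lborel. u y)"

text \<open>The supremum at one point is paired with the infimum at the other one: the two tokens move
  apart, which costs at most \<^term>\<open>P\<close>. The remaining pair is estimated by the single choice
  \<^term>\<open>z1\<close>, \<^term>\<open>z2\<close>, by which both tokens may move towards each other. The noise is the
  same vector at both points.\<close>

lemma tug_noise_average_diff_le:
  fixes u :: "'a::euclidean_space \<Rightarrow> real"
  assumes \<epsilon>: "\<epsilon> > 0" and \<alpha>: "\<alpha> \<ge> 0" and \<beta>: "\<beta> \<ge> 0"
    and bdd: "bounded (u ` ball y1 \<epsilon>)" "bounded (u ` ball y2 \<epsilon>)"
    and int: "set_integrable lborel (ball y1 \<epsilon>) u" "set_integrable lborel (ball y2 \<epsilon>) u"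
    and P: "\<And>a b. a \<in> ball y1 \<epsilon> \<Longrightarrow> b \<in> ball y2 \<epsilon> \<Longrightarrow> u a - u b \<le> P"
    and z: "z1 \<in> ball y1 \<epsilon>" "z2 \<in> ball y2 \<epsilon>" and Q: "u z1 - u z2 \<le> Q"
    and g: "\<And>v. v \<in> ball 0 \<epsilon> \<Longrightarrow> u (y1 + v) - u (y2 + v) \<le> g v"
    and int_g: "set_integrable lborel (ball 0 \<epsilon>) g"
  shows "tug_noise_average \<alpha> \<beta> \<epsilon> u y1 - tug_noise_average \<alpha> \<beta> \<epsilon> u y2
           \<le> \<alpha> / 2 * (P + Q) + \<beta> / measure lborel (ball (0::'a) \<epsilon>) * (LINT v:ball 0 \<epsilon>|lborel. g v)"
proof -
  let ?m = "measure lborel (ball (0::'a) \<epsilon>)"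
  have regroup: "a * s + b * l - (a * s' + b * l') = a * (s - s') + b * (l - l')"
    for a b s s' l l' :: real
    by (simp add: algebra_simps)
  have m: "measure lborel (ball y \<epsilon>) = ?m" for y :: 'a
    using \<epsilon> by (simp add: content_ball)
  have SUP1: "(SUP y\<in>ball y1 \<epsilon>. u y) \<le> P + u b" if "b \<in> ball y2 \<epsilon>" for b
    using P[OF _ that] \<epsilon> by (intro cSUP_least) (auto simp: algebra_simps)
  have "(SUP y\<in>ball y1 \<epsilon>. u y) - P \<le> (INF y\<in>ball y2 \<epsilon>. u y)"
    using SUP1 \<epsilon> by (intro cINF_greatest) (auto simp: algebra_simps)
  moreover have "(INF y\<in>ball y1 \<epsilon>. u y) \<le> u z1"
    using z bdd by (intro cINF_lower bounded_imp_bdd_below)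
  moreover have "u z2 \<le> (SUP y\<in>ball y2 \<epsilon>. u y)"
    using z bdd by (intro cSUP_upper bounded_imp_bdd_above)
  ultimately have tug: "((INF y\<in>ball y1 \<epsilon>. u y) + (SUP y\<in>ball y1 \<epsilon>. u y))
      - ((INF y\<in>ball y2 \<epsilon>. u y) + (SUP y\<in>ball y2 \<epsilon>. u y)) \<le> P + Q"
    using Q by linarith
  have "(LINT y:ball y1 \<epsilon>|lborel. u y) - (LINT y:ball y2 \<epsilon>|lborel. u y)
      = (LINT v:ball 0 \<epsilon>|lborel. u (y1 + v) - u (y2 + v))"
    unfolding set_integral_ball_translate[OF int(1)] set_integral_ball_translate[OF int(2)]
    by (rule set_integral_diff(2)[symmetric]) (rule set_integrable_ball_translate[OF int(1)]
        set_integrable_ball_translate[OF int(2)])+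
  also have "\<dots> \<le> (LINT v:ball 0 \<epsilon>|lborel. g v)"
    using int g int_g
    by (intro set_integral_mono set_integral_diff(1) set_integrable_ball_translate) auto
  finally have noise: "(LINT y:ball y1 \<epsilon>|lborel. u y) - (LINT y:ball y2 \<epsilon>|lborel. u y)
      \<le> (LINT v:ball 0 \<epsilon>|lborel. g v)" .
  have "tug_noise_average \<alpha> \<beta> \<epsilon> u y1 - tug_noise_average \<alpha> \<beta> \<epsilon> u y2
      = \<alpha> / 2 * (((INF y\<in>ball y1 \<epsilon>. u y) + (SUP y\<in>ball y1 \<epsilon>. u y))
          - ((INF y\<in>ball y2 \<epsilon>. u y) + (SUP y\<in>ball y2 \<epsilon>. u y)))
        + \<beta> / ?m * ((LINT y:ball y1 \<epsilon>|lborel. u y) - (LINT y:ball y2 \<epsilon>|lborel. u y))"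
    unfolding tug_noise_average_def m[of y1] m[of y2] by (rule regroup)
  also have "\<dots> \<le> \<alpha> / 2 * (P + Q) + \<beta> / ?m * (LINT v:ball 0 \<epsilon>|lborel. g v)"
    using \<alpha> \<beta> by (intro add_mono mult_left_mono tug noise) auto
  finally show ?thesis .
qed

section \<open>The barrier and the comparison argument\<close>

text \<open>The possible positions of a token whose steps away from \<open>x\<close> exceed the cancelled ones by
  \<open>k\<close>. The centre is inserted because the open ball of radius 0 is empty.\<close>

definition reach :: "real \<Rightarrow> nat \<Rightarrow> 'a::metric_space \<Rightarrow> 'a set" where
  "reach \<epsilon> k x = insert x (ball x (real k * \<epsilon>))"

lemma reach_0 [simp]: "reach \<epsilon> 0 x = {x}"
  by (simp add: reach_def)

lemma reach_dist:
  assumes "y \<in> reach \<epsilon> k x" "\<epsilon> > 0"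
  shows "dist x y \<le> real k * \<epsilon>"
  using assms by (auto simp: reach_def)

lemma reach_Suc:
  assumes "y \<in> reach \<epsilon> k x" "\<epsilon> > 0" "a \<in> ball y \<epsilon>"
  shows "a \<in> reach \<epsilon> (Suc k) x"
proof -
  have "dist x a \<le> dist x y + dist y a" by (rule dist_triangle)
  also have "\<dots> < real k * \<epsilon> + \<epsilon>"
    using reach_dist[OF assms(1,2)] assms(3) by auto
  finally show ?thesis by (auto simp: reach_def algebra_simps)
qed

lemma reach_translate:
  fixes x :: "'a::real_normed_vector"
  shows "y \<in> reach \<epsilon> k x \<Longrightarrow> y + v \<in> reach \<epsilon> k (x + v)"
  by (auto simp: reach_def dist_norm)

text \<open>A token can cancel one step by moving straight back towards the centre.\<close>

lemma reach_cancel_step: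
  fixes x :: "'a::real_normed_vector"
  assumes y: "y \<in> reach \<epsilon> (Suc k) x" and \<epsilon>: "\<epsilon> > 0"
  obtains z where "z \<in> reach \<epsilon> k x" "z \<in> ball y \<epsilon>"
proof
  let ?z = "x + (real k / real (Suc k)) *\<^sub>R (y - x)"
  have lt: "norm (y - x) < real (Suc k) * \<epsilon>"
    using y \<epsilon> by (auto simp: reach_def dist_norm norm_minus_commute)
  have q: "norm (y - x) / real (Suc k) < \<epsilon>"
    using lt by (simp add: divide_simps algebra_simps)
  have "y - ?z = (1 - real k / real (Suc k)) *\<^sub>R (y - x)"
    by (simp add: algebra_simps)
  also have "1 - real k / real (Suc k) = 1 / real (Suc k)"
    by (simp add: field_simps)
  finally have "dist y ?z = norm (y - x) / real (Suc k)"
    by (simp add: dist_norm)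
  then show "?z \<in> ball y \<epsilon>" using q by simp
  show "?z \<in> reach \<epsilon> k x"
  proof (cases "k = 0")
    case False
    have "dist x ?z = real k * (norm (y - x) / real (Suc k))"
      by (simp add: dist_norm)
    also have "\<dots> < real k * \<epsilon>"
      using False q by (intro mult_strict_left_mono) auto
    finally show ?thesis by (simp add: reach_def)
  qed simp
qed

text \<open>The term in \<open>x\<close> makes the barrier at least 1 at distance \<open>r/4\<close> from \<open>c\<close>. The coefficient
  \<open>d/2 + 4\<close> is the least one for which the term in \<open>k\<epsilon>\<close> dominates \<open>4k\<epsilon>/r\<close> all the way up to
  \<open>k\<epsilon> = r/2\<close>, so that it is at least 1 from \<open>k\<epsilon> = r/4\<close> on.\<close>

definition barrier :: "real \<Rightarrow> real \<Rightarrow> 'a::real_normed_vector \<Rightarrow> real \<Rightarrow> real \<Rightarrow> 'a \<Rightarrow> real" where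
  "barrier d r c \<epsilon> k x =
     16 * (norm (x - c) / r)\<^sup>2 + (d / 2 + 4) * (k * \<epsilon> / r) - d * (k * \<epsilon> / r)\<^sup>2"

lemma barrier_radial_part:
  fixes d s :: real
  assumes "d \<ge> 0" "0 \<le> s" "s \<le> 1 / 2"
  shows "4 * s \<le> (d / 2 + 4) * s - d * s\<^sup>2"
proof -
  have "0 \<le> d * s * (1 / 2 - s)" using assms by simp
  then show ?thesis by (simp add: algebra_simps power2_eq_square)
qed

lemma barrier_nonneg:
  assumes "d \<ge> 0" "0 \<le> k * \<epsilon>" "k * \<epsilon> \<le> r / 2" "r > 0"
  shows "0 \<le> barrier d r c \<epsilon> k x"
proof -
  have "0 \<le> k * \<epsilon> / r" "k * \<epsilon> / r \<le> 1 / 2" using assms by (auto simp: field_simps)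
  with barrier_radial_part[of d "k * \<epsilon> / r"] assms(1) show ?thesis
    unfolding barrier_def by (smt (verit) zero_le_power2)
qed

lemma barrier_ge_1:
  assumes "d \<ge> 0" "0 \<le> k * \<epsilon>" "k * \<epsilon> \<le> r / 2" "r > 0"
    and far: "r / 4 \<le> norm (x - c) \<or> r / 4 \<le> k * \<epsilon>"
  shows "1 \<le> barrier d r c \<epsilon> k x"
proof -
  have s: "0 \<le> k * \<epsilon> / r" "k * \<epsilon> / r \<le> 1 / 2" using assms by (auto simp: field_simps)
  note rad = barrier_radial_part[OF assms(1) s]
  from far show ?thesis
  proof
    assume "r / 4 \<le> norm (x - c)"
    then have "(1 / 4)\<^sup>2 \<le> (norm (x - c) / r)\<^sup>2"
      using \<open>r > 0\<close> by (intro power_mono) (auto simp: field_simps)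
    then have "1 \<le> 16 * (norm (x - c) / r)\<^sup>2" by (simp add: power2_eq_square mult_ac)
    with rad s show ?thesis unfolding barrier_def by linarith
  next
    assume "r / 4 \<le> k * \<epsilon>"
    then have "1 \<le> 4 * (k * \<epsilon> / r)" using \<open>r > 0\<close> by (simp add: field_simps)
    with rad show ?thesis unfolding barrier_def by (smt (verit) zero_le_power2)
  qed
qed

lemma barrier_second_difference:
  "barrier d r c \<epsilon> (k + 1) x + barrier d r c \<epsilon> (k - 1) x
     = 2 * barrier d r c \<epsilon> k x - 2 * d * (\<epsilon> / r)\<^sup>2"
proof -
  have "(k + 1) * \<epsilon> / r = k * \<epsilon> / r + \<epsilon> / r" "(k - 1) * \<epsilon> / r = k * \<epsilon> / r - \<epsilon> / r"
    by (auto simp: add_divide_distrib diff_divide_distrib algebra_simps)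
  then show ?thesis
    unfolding barrier_def by (simp only:) (simp add: algebra_simps power2_eq_square)
qed

lemma continuous_on_barrier [continuous_intros]:
  "continuous_on S f \<Longrightarrow> continuous_on S (\<lambda>v. barrier d r c \<epsilon> k (f v))"
  unfolding barrier_def divide_inverse by (intro continuous_intros)

lemma set_integral_barrier_le:
  fixes x :: "'a::euclidean_space"
  assumes "\<epsilon> > 0" "r > 0"
  shows "(LINT v:ball 0 \<epsilon>|lborel. barrier d r c \<epsilon> k (x + v))
           \<le> (barrier d r c \<epsilon> k x + 16 * (\<epsilon> / r)\<^sup>2) * measure lborel (ball (0::'a) \<epsilon>)"
proof -
  let ?B = "ball (0::'a) \<epsilon>" and ?w = "x - c"
  let ?e = "(d / 2 + 4) * (k * \<epsilon> / r) - d * (k * \<epsilon> / r)\<^sup>2"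
  have "barrier d r c \<epsilon> k (x + v) = 16 / r\<^sup>2 * (norm (?w + v))\<^sup>2 + ?e" for v
    by (simp add: barrier_def power_divide algebra_simps)
  then have "(LINT v:?B|lborel. barrier d r c \<epsilon> k (x + v))
      = (LINT v:?B|lborel. 16 / r\<^sup>2 * (norm (?w + v))\<^sup>2 + ?e)"
    by simp
  also have "\<dots> = (LINT v:?B|lborel. 16 / r\<^sup>2 * (norm (?w + v))\<^sup>2) + (LINT v:?B|lborel. ?e)"
    by (intro set_integral_add(2) set_integrable_ball_continuous continuous_intros)
  also have "\<dots> = 16 / r\<^sup>2 * (LINT v:?B|lborel. (norm (?w + v))\<^sup>2) + ?e * measure lborel ?B"
    by (simp add: set_lebesgue_integral_def)
  also have "\<dots> \<le> 16 / r\<^sup>2 * (((norm ?w)\<^sup>2 + \<epsilon>\<^sup>2) * measure lborel ?B) + ?e * measure lborel ?B"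
    using assms by (intro add_right_mono mult_left_mono set_integral_norm_square_le) auto
  also have "\<dots> = (barrier d r c \<epsilon> k x + 16 * (\<epsilon> / r)\<^sup>2) * measure lborel ?B"
    by (simp add: barrier_def power_divide algebra_simps add_divide_distrib)
  finally show ?thesis .
qed

locale tug_noise_ball =
  fixes u :: "'a::euclidean_space \<Rightarrow> real" and \<alpha> \<beta> \<epsilon> r \<omega> :: real and c :: 'a
  assumes tug_pos: "\<alpha> > 0" and noise_nonneg: "\<beta> \<ge> 0" and weights_sum: "\<alpha> + \<beta> = 1"
    and step_pos: "\<epsilon> > 0" and step_le: "\<epsilon> \<le> r / 4"
    and dpp: "\<And>x. x \<in> ball c r \<Longrightarrow> u x = tug_noise_average \<alpha> \<beta> \<epsilon> u x"
    and bounded_on_ball: "bounded (u ` ball c r)"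
    and integrable_on_ball: "set_integrable lborel (ball c r) u"
    and diff_le: "\<And>x y. x \<in> ball c r \<Longrightarrow> y \<in> ball c r \<Longrightarrow> u x - u y \<le> \<omega>"
begin

text \<open>Averaging the barrier over one round changes it by at most \<open>(16\<beta> - \<alpha>d)(\<epsilon>/r)\<^sup>2\<close>; the value of
  \<open>d\<close> makes this \<open>-(\<epsilon>/r)\<^sup>2\<close>.\<close>

definition d :: real where "d = (16 * \<beta> + 1) / \<alpha>"

abbreviation \<Phi> :: "real \<Rightarrow> 'a \<Rightarrow> real" where "\<Phi> \<equiv> barrier d r c \<epsilon>"

text \<open>The oscillation estimate with excess \<open>M\<close>, written as a bound on differences of values. No
  supremum is formed in \<open>x\<close>, so no measurability of the oscillation in \<open>x\<close> is involved.\<close>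

definition below_barrier :: "real \<Rightarrow> bool" where
  "below_barrier M \<longleftrightarrow> (\<forall>k x. dist c x \<le> r / 2 \<longrightarrow> real k * \<epsilon> \<le> r / 2 \<longrightarrow>
     (\<forall>y1\<in>reach \<epsilon> k x. \<forall>y2\<in>reach \<epsilon> k x. u y1 - u y2 \<le> \<omega> * \<Phi> (real k) x + M))"

lemma radius_pos: "r > 0"
  using step_pos step_le by simp

lemma d_nonneg: "d \<ge> 0"
  using tug_pos noise_nonneg by (simp add: d_def)

lemma osc_nonneg: "\<omega> \<ge> 0"
  using diff_le[of c c] radius_pos by simp

lemma reach_in_ball:
  assumes "dist c x \<le> r / 2" "real k * \<epsilon> \<le> r / 2" "y \<in> reach \<epsilon> k x"
  shows "y \<in> ball c r"
proof -
  have "dist c y \<le> dist c x + dist x y" by (rule dist_triangle)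
  then show ?thesis
    using assms radius_pos by (auto simp: reach_def)
qed

text \<open>At an interior point the coupled round turns the bound with excess \<^term>\<open>M\<close> into an
  average of the same bound; the strict supersolution property of the barrier leaves a gain of
  \<^term>\<open>\<omega> * (\<epsilon> / r)\<^sup>2\<close>.\<close>

lemma below_barrier_interior:
  assumes M: "below_barrier M"
    and x: "dist c x < r / 4" and k: "real (Suc k) * \<epsilon> < r / 4"
    and y: "y1 \<in> reach \<epsilon> (Suc k) x" "y2 \<in> reach \<epsilon> (Suc k) x"
  shows "u y1 - u y2 \<le> \<omega> * \<Phi> (real (Suc k)) x + M - \<omega> * (\<epsilon> / r)\<^sup>2"
proof -
  let ?k = "real (Suc k)" and ?m = "measure lborel (ball (0::'a) \<epsilon>)"
  have bound: "u a - u b \<le> \<omega> * \<Phi> (real j) z + M"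
    if "dist c z \<le> r / 2" "real j * \<epsilon> \<le> r / 2" "a \<in> reach \<epsilon> j z" "b \<in> reach \<epsilon> j z" for a b j z
    using M that unfolding below_barrier_def by blast
  have k1: "real k * \<epsilon> \<le> r / 2" "real (Suc k) * \<epsilon> \<le> r / 2" "real (Suc (Suc k)) * \<epsilon> \<le> r / 2"
    using k step_pos step_le by (auto simp: algebra_simps)
  have x1: "dist c x \<le> r / 2" using x radius_pos by simp
  have x2: "dist c (x + v) \<le> r / 2" if "v \<in> ball 0 \<epsilon>" for v
  proof -
    have "dist c (x + v) \<le> dist c x + dist x (x + v)" by (rule dist_triangle)
    then show ?thesis using x that step_le by (simp add: dist_norm)
  qed
  have sub: "ball y \<epsilon> \<subseteq> ball c r" if "y \<in> reach \<epsilon> (Suc k) x" for y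
    using reach_in_ball[OF x1 k1(3)] reach_Suc[OF that step_pos] by blast
  obtain z1 where z1: "z1 \<in> reach \<epsilon> k x" "z1 \<in> ball y1 \<epsilon>"
    using reach_cancel_step[OF y(1) step_pos] .
  obtain z2 where z2: "z2 \<in> reach \<epsilon> k x" "z2 \<in> ball y2 \<epsilon>"
    using reach_cancel_step[OF y(2) step_pos] .
  let ?g = "\<lambda>v. \<omega> * \<Phi> ?k (x + v) + M"
  have int_g: "set_integrable lborel (ball 0 \<epsilon>) (\<lambda>v. \<omega> * \<Phi> ?k (x + v))"
    "set_integrable lborel (ball (0::'a) \<epsilon>) (\<lambda>v. M)"
    by (intro set_integrable_ball_continuous continuous_intros)+
  have "u y1 - u y2 = tug_noise_average \<alpha> \<beta> \<epsilon> u y1 - tug_noise_average \<alpha> \<beta> \<epsilon> u y2"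
    using dpp[OF reach_in_ball[OF x1 k1(2) y(1)]] dpp[OF reach_in_ball[OF x1 k1(2) y(2)]] by simp
  also have "\<dots> \<le> \<alpha> / 2 * ((\<omega> * \<Phi> (real (Suc (Suc k))) x + M) + (\<omega> * \<Phi> (real k) x + M))
      + \<beta> / ?m * (LINT v:ball 0 \<epsilon>|lborel. ?g v)"
  proof (rule tug_noise_average_diff_le[where ?z1.0 = z1 and ?z2.0 = z2])
    show "bounded (u ` ball y1 \<epsilon>)" "bounded (u ` ball y2 \<epsilon>)"
      using bounded_on_ball sub[OF y(1)] sub[OF y(2)] by (blast intro: bounded_subset)+
    show "set_integrable lborel (ball y1 \<epsilon>) u" "set_integrable lborel (ball y2 \<epsilon>) u"
      by (rule set_integrable_subset[OF integrable_on_ball]; use sub y in simp)+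
    show "u a - u b \<le> \<omega> * \<Phi> (real (Suc (Suc k))) x + M"
      if "a \<in> ball y1 \<epsilon>" "b \<in> ball y2 \<epsilon>" for a b
      using reach_Suc[OF y(1) step_pos that(1)] reach_Suc[OF y(2) step_pos that(2)]
      by (intro bound[OF x1 k1(3)])
    show "u (y1 + v) - u (y2 + v) \<le> ?g v" if "v \<in> ball 0 \<epsilon>" for v
      using y by (intro bound[OF x2[OF that] k1(2)] reach_translate)
    show "set_integrable lborel (ball 0 \<epsilon>) ?g"
      using int_g by (rule set_integral_add(1))
  qed (use z1 z2 step_pos tug_pos noise_nonneg bound[OF x1 k1(1) z1(1) z2(1)] in simp_all)
  also have "\<dots> \<le> \<alpha> / 2 * ((\<omega> * \<Phi> (real (Suc (Suc k))) x + M) + (\<omega> * \<Phi> (real k) x + M))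
      + \<beta> / ?m * ((\<omega> * (\<Phi> ?k x + 16 * (\<epsilon> / r)\<^sup>2) + M) * ?m)"
  proof (intro add_left_mono mult_left_mono)
    have "(LINT v:ball 0 \<epsilon>|lborel. ?g v) = \<omega> * (LINT v:ball 0 \<epsilon>|lborel. \<Phi> ?k (x + v)) + M * ?m"
      using set_integral_add(2)[OF int_g] by (simp add: set_lebesgue_integral_def)
    also have "\<dots> \<le> \<omega> * ((\<Phi> ?k x + 16 * (\<epsilon> / r)\<^sup>2) * ?m) + M * ?m"
      using osc_nonneg step_pos radius_pos
      by (intro add_right_mono mult_left_mono set_integral_barrier_le)
    finally show "(LINT v:ball 0 \<epsilon>|lborel. ?g v) \<le> (\<omega> * (\<Phi> ?k x + 16 * (\<epsilon> / r)\<^sup>2) + M) * ?m"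
      by (simp add: algebra_simps)
  qed (use noise_nonneg in simp)
  also have "\<dots> = \<omega> * \<Phi> ?k x + M - \<omega> * (\<epsilon> / r)\<^sup>2"
  proof -
    have "?m > 0" using step_pos by (rule content_ball_pos)
    then have "\<beta> / ?m * ((\<omega> * (\<Phi> ?k x + 16 * (\<epsilon> / r)\<^sup>2) + M) * ?m)
        = \<beta> * (\<omega> * (\<Phi> ?k x + 16 * (\<epsilon> / r)\<^sup>2) + M)"
      by simp
    moreover have "\<Phi> (real (Suc (Suc k))) x + \<Phi> (real k) x = 2 * \<Phi> ?k x - 2 * d * (\<epsilon> / r)\<^sup>2"
      using barrier_second_difference[of d r c \<epsilon> ?k x] by (simp add: add.commute)
    then have "\<alpha> / 2 * ((\<omega> * \<Phi> (real (Suc (Suc k))) x + M) + (\<omega> * \<Phi> (real k) x + M))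
        = \<alpha> * \<omega> * \<Phi> ?k x - \<omega> * (\<alpha> * d) * (\<epsilon> / r)\<^sup>2 + \<alpha> * M"
      by algebra
    moreover have "\<alpha> * d = 16 * \<beta> + 1" using tug_pos by (simp add: d_def)
    moreover have "\<beta> = 1 - \<alpha>" using weights_sum by simp
    ultimately show ?thesis by (simp only:) (simp add: algebra_simps)
  qed
  finally show ?thesis .
qed

text \<open>Outside the interior no excess is present at all: for \<open>k = 0\<close> both values coincide, and far
  from \<open>(c, 0)\<close> the barrier is at least 1.\<close>

lemma below_barrier_improve:
  assumes M: "below_barrier M"
  shows "below_barrier (max 0 (M - \<omega> * (\<epsilon> / r)\<^sup>2))"
  unfolding below_barrier_def
proof (intro allI impI ballI)
  fix k x y1 y2
  assume x: "dist c x \<le> r / 2" and k: "real k * \<epsilon> \<le> r / 2"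
    and y: "y1 \<in> reach \<epsilon> k x" "y2 \<in> reach \<epsilon> k x"
  have nonneg: "0 \<le> real k * \<epsilon>" using step_pos by simp
  consider "k = 0" | "r / 4 \<le> dist c x \<or> r / 4 \<le> real k * \<epsilon>"
    | j where "k = Suc j" "dist c x < r / 4" "real k * \<epsilon> < r / 4"
    by (cases k) force+
  then show "u y1 - u y2 \<le> \<omega> * \<Phi> (real k) x + max 0 (M - \<omega> * (\<epsilon> / r)\<^sup>2)"
  proof cases
    case 1
    have "0 \<le> \<omega> * \<Phi> (real k) x"
      by (intro mult_nonneg_nonneg osc_nonneg barrier_nonneg d_nonneg nonneg k radius_pos)
    with y 1 show ?thesis by simp
  next
    case 2
    then have "1 \<le> \<Phi> (real k) x"
      by (intro barrier_ge_1 d_nonneg nonneg k radius_pos) (simp add: dist_norm norm_minus_commute)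
    then have "\<omega> * 1 \<le> \<omega> * \<Phi> (real k) x" using osc_nonneg by (rule mult_left_mono)
    moreover have "u y1 - u y2 \<le> \<omega>"
      using reach_in_ball[OF x k] y by (intro diff_le) auto
    ultimately show ?thesis by simp
  next
    case 3
    then show ?thesis using below_barrier_interior[OF M, of x j y1 y2] y by simp
  qed
qed

text \<open>The oscillation need not attain its maximal excess over the barrier, so the comparison
  principle is proved by repeating the improvement: every repetition removes the same positive
  amount, starting from the excess \<open>\<omega>\<close>.\<close>

lemma below_barrier_0: "below_barrier 0"
proof -
  let ?\<delta> = "\<omega> * (\<epsilon> / r)\<^sup>2"
  have "below_barrier (max 0 (\<omega> - real j * ?\<delta>))" for j
  proof (induction j)
    case 0
    have "u y1 - u y2 \<le> \<omega> * \<Phi> (real k) x + max 0 \<omega>"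
      if "dist c x \<le> r / 2" "real k * \<epsilon> \<le> r / 2" "y1 \<in> reach \<epsilon> k x" "y2 \<in> reach \<epsilon> k x"
      for k x y1 y2
    proof -
      have "0 \<le> \<omega> * \<Phi> (real k) x"
        using step_pos that(2)
        by (intro mult_nonneg_nonneg osc_nonneg barrier_nonneg d_nonneg radius_pos) auto
      moreover have "u y1 - u y2 \<le> \<omega>"
        using reach_in_ball[OF that(1,2)] that by (intro diff_le) auto
      ultimately show ?thesis by simp
    qed
    then show ?case by (simp add: below_barrier_def)
  next
    case (Suc j)
    have "0 \<le> ?\<delta>" using osc_nonneg by simp
    then have "max 0 (max 0 (\<omega> - real j * ?\<delta>) - ?\<delta>) = max 0 (\<omega> - real (Suc j) * ?\<delta>)"
      by (simp add: algebra_simps max_def)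
    with below_barrier_improve[OF Suc] show ?case by simp
  qed
  moreover obtain j where "\<omega> \<le> real j * ?\<delta>"
  proof (cases "\<omega> = 0")
    case True
    with that[of 0] show ?thesis by simp
  next
    case False
    then have "?\<delta> > 0" using osc_nonneg step_pos radius_pos by simp
    then show ?thesis using that reals_Archimedean3 less_imp_le by blast
  qed
  ultimately show ?thesis by (metis diff_le_0_iff_le max.absorb1)
qed

text \<open>On the axis through the centre the barrier is at most linear in the radius. Rounding
  \<^term>\<open>\<rho>\<close> up to a multiple of the step at most doubles it, because \<^term>\<open>\<epsilon> \<le> \<rho>\<close>.\<close>

lemma diff_le_linear:
  assumes \<rho>: "\<epsilon> \<le> \<rho>" "\<rho> \<le> r / 4" and y: "y1 \<in> ball c \<rho>" "y2 \<in> ball c \<rho>"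
  shows "u y1 - u y2 \<le> (d + 8) * (\<rho> / r) * \<omega>"
proof -
  define k where "k = nat \<lceil>\<rho> / \<epsilon>\<rceil>"
  have "0 \<le> \<rho> / \<epsilon>" using \<rho> step_pos by simp
  then have "\<rho> / \<epsilon> \<le> real k" "real k \<le> \<rho> / \<epsilon> + 1"
    unfolding k_def by linarith+
  then have "\<rho> \<le> real k * \<epsilon>" "real k * \<epsilon> \<le> \<rho> + \<epsilon>"
    using step_pos by (auto simp: field_simps)
  then have k: "\<rho> \<le> real k * \<epsilon>" "real k * \<epsilon> \<le> 2 * \<rho>"
    using \<rho> by auto
  have "u y1 - u y2 \<le> \<omega> * \<Phi> (real k) c"
    using below_barrier_0 k \<rho> y radius_pos
    unfolding below_barrier_def by (force simp: reach_def)
  also have "\<dots> \<le> \<omega> * ((d + 8) * (\<rho> / r))"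
  proof -
    have "\<Phi> (real k) c \<le> (d / 2 + 4) * (real k * \<epsilon> / r)"
      using d_nonneg by (simp add: barrier_def)
    also have "\<dots> \<le> (d / 2 + 4) * (2 * \<rho> / r)"
      using d_nonneg k radius_pos by (intro mult_left_mono divide_right_mono) auto
    also have "\<dots> = (d + 8) * (\<rho> / r)" by (simp add: distrib_right)
    finally show ?thesis
      using osc_nonneg by (rule mult_left_mono)
  qed
  finally show ?thesis by (simp add: mult_ac)
qed

end

section \<open>Oscillation estimate\<close>

lemma osc_le:
  assumes "B \<noteq> {}" and "\<And>x y. x \<in> B \<Longrightarrow> y \<in> B \<Longrightarrow> u x - u y \<le> K"
  shows "osc u B \<le> K"
proof -
  have "(SUP x\<in>B. u x) \<le> K + u y" if "y \<in> B" for y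
    using assms that by (intro cSUP_least) (auto simp: algebra_simps)
  then have "(SUP x\<in>B. u x) - K \<le> (INF y\<in>B. u y)"
    using assms(1) by (intro cINF_greatest) (auto simp: algebra_simps)
  then show ?thesis by (simp add: osc_def)
qed

lemma diff_le_osc:
  assumes "bounded (u ` B)" "x \<in> B" "y \<in> B"
  shows "u x - u y \<le> osc u B"
proof -
  have "u x \<le> (SUP x\<in>B. u x)" "(INF x\<in>B. u x) \<le> u y"
    using assms by (auto intro!: cSUP_upper cINF_lower bounded_imp_bdd_above bounded_imp_bdd_below)
  then show ?thesis by (simp add: osc_def)
qed

lemma p_harmonious_set_integrable:
  fixes u :: "real ^ 'n \<Rightarrow> real"
  assumes u: "p_harmonious p \<epsilon> \<Omega> u" and sub: "ball c r \<subseteq> \<Omega>"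
  shows "set_integrable lborel (ball c r) u"
proof -
  let ?f = "\<lambda>x. indicator (ball c r) x *\<^sub>R u x"
  have sub': "ball c r \<subseteq> extended_domain \<epsilon> \<Omega>" using sub by (auto simp: extended_domain_def)
  have "u \<in> borel_measurable (restrict_space borel (ball c r))"
    using u sub' unfolding p_harmonious_def by (blast intro: measurable_restrict_mono)
  then have meas: "?f \<in> borel_measurable lborel"
    by (subst (asm) borel_measurable_restrict_space_iff) auto
  obtain K where K: "\<And>x. x \<in> ball c r \<Longrightarrow> norm (u x) \<le> K"
    using u sub' unfolding p_harmonious_def bounded_iff by blast
  have "integrable lborel (\<lambda>x. indicator (ball c r) x *\<^sub>R ?f x)"
    using meas K
    by (intro integrableI_bounded_set_indicator[where B = K])
       (use emeasure_lborel_ball_finite[of c r] in auto)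
  moreover have "(\<lambda>x. indicator (ball c r) x *\<^sub>R ?f x) = ?f"
    by (auto simp: indicator_def)
  ultimately show ?thesis by (simp add: set_integrable_def)
qed

theorem corollary3p3:
  fixes p :: real
  assumes "p > 2"
  shows "\<exists>C::real. \<forall>(\<Omega> :: (real ^ 'n::finite) set) (\<epsilon>::real) (u :: real ^ 'n \<Rightarrow> real).
           bounded_domain \<Omega> \<longrightarrow> \<epsilon> > 0 \<longrightarrow> p_harmonious p \<epsilon> \<Omega> u \<longrightarrow>
           (\<forall>x\<in>extended_domain \<epsilon> \<Omega>. u x > 0) \<longrightarrow>
           (\<forall>(c :: real ^ 'n) (\<rho>::real) (r::real).
              \<epsilon> \<le> \<rho> \<longrightarrow> \<rho> \<le> r \<longrightarrow> ball c (2 * r) \<subseteq> \<Omega> \<longrightarrow>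
              osc u (ball c \<rho>) \<le> C * (\<rho> / r) * osc u (ball c r))"
proof -
  let ?\<alpha> = "tug_weight TYPE('n) p" and ?\<beta> = "noise_weight TYPE('n) p"
  define C where "C = (16 * ?\<beta> + 1) / ?\<alpha> + 8"
  have weights: "?\<alpha> > 0" "?\<beta> \<ge> 0" "?\<alpha> + ?\<beta> = 1"
    using assms by (auto simp: tug_weight_def noise_weight_def field_simps add_nonneg_eq_0_iff)
  have C: "C \<ge> 4" using weights by (simp add: C_def)
  have "osc u (ball c \<rho>) \<le> C * (\<rho> / r) * osc u (ball c r)"
    if \<epsilon>: "\<epsilon> > 0" and u: "p_harmonious p \<epsilon> \<Omega> u" and \<rho>: "\<epsilon> \<le> \<rho>" "\<rho> \<le> r"
      and sub2: "ball c (2 * r) \<subseteq> \<Omega>"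
    for \<Omega> :: "(real ^ 'n) set" and \<epsilon> \<rho> r c u
  proof -
    have sub: "ball c r \<subseteq> \<Omega>" using sub2 \<epsilon> \<rho> by (auto simp: subset_iff)
    have bdd: "bounded (u ` ball c r)"
      using u sub unfolding p_harmonious_def extended_domain_def by (blast intro: bounded_subset)
    have diff: "u x - u y \<le> osc u (ball c r)" if "x \<in> ball c r" "y \<in> ball c r" for x y
      using diff_le_osc[OF bdd that] .
    have "u x - u y \<le> C * (\<rho> / r) * osc u (ball c r)" if xy: "x \<in> ball c \<rho>" "y \<in> ball c \<rho>" for x y
    proof (cases "\<rho> \<le> r / 4")
      case True
      interpret tug_noise_ball u ?\<alpha> ?\<beta> \<epsilon> r "osc u (ball c r)" c
      proof
        show "u x = tug_noise_average ?\<alpha> ?\<beta> \<epsilon> u x" if "x \<in> ball c r" for x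
          using u sub that unfolding p_harmonious_def tug_noise_average_def by blast
      qed (use weights \<epsilon> \<rho> True bdd diff p_harmonious_set_integrable[OF u sub] in auto)
      show ?thesis
        using diff_le_linear[OF \<rho>(1) True xy] by (simp add: C_def d_def)
    next
      case False
      have "1 \<le> 4 * (\<rho> / r)" using False \<epsilon> \<rho> by (simp add: field_simps)
      also have "\<dots> \<le> C * (\<rho> / r)" using C \<epsilon> \<rho> by (intro mult_right_mono) auto
      finally have "1 * osc u (ball c r) \<le> C * (\<rho> / r) * osc u (ball c r)"
        using diff[of c c] \<epsilon> \<rho> by (intro mult_right_mono) auto
      then show ?thesis using diff[of x y] xy \<rho> by auto
    qed
    then show ?thesis using \<epsilon> \<rho> by (intro osc_le) auto
  qed
  then show ?thesis by blast
qed

end
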